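(* Let $p_1,p_2$ be monic complex polynomials of degrees $d_1,d_2$ with distinct roots $\Lambda_1=\{\lambda_1,\dots,\lambda_{d_1}\}$ and $\Lambda_2=\{\mu_1,\dots,\mu_{d_2}\}$, let $M_1,M_2\subset\mathbb{C}$ be compact, and let $X=C_{\Lambda_1\times\Lambda_2}(M_1\times M_2)$. For $(z_1,z_2)\in p_1^{-1}(M_1)\times p_2^{-1}(M_2)$ define $$\chi_{(z_1,z_2)}:X\to\mathbb{C},\qquad \chi_{(z_1,z_2)}(f)=\sum_{j=1}^{d_1}\sum_{k=1}^{d_2}\delta_{1,j}(z_1)\,\delta_{2,k}(z_2)\,f_{j,k}(p_1(z_1),p_2(z_2)).$$ Then the set of all characters of $X$ is exactly $$\{\chi_{(z_1,z_2)}:(z_1,z_2)\in p_1^{-1}(M_1)\times p_2^{-1}(M_2)\}.$$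
   Context: $\delta_{1,j}(z)=\frac{p_1(z)}{p_1'(\lambda_j)(z-\lambda_j)}$ and $\delta_{2,k}(z)=\frac{p_2(z)}{p_2'(\mu_k)(z-\mu_k)}$ are the Lagrange interpolation polynomials at the roots of $p_1$ and of $p_2$ (so $\delta_{1,j}(\lambda_l)$ is $1$ if $l=j$ and $0$ otherwise, and similarly for $\delta_{2,k}$). Put $\sigma_{1,jl}=\frac{1}{p_1'(\lambda_l)}\frac{1}{\lambda_j-\lambda_l}$ for $j\ne l$ and $\sigma_{2,km}=\frac{1}{p_2'(\mu_m)}\frac{1}{\mu_k-\mu_m}$ for $k\neq m$. For functions $f,g: M_1\times M_2\to\mathbb{C}^{d_1\times d_2}$ with components $f_{j,k},g_{j,k}$, the polyproduct $f\circledcirc g$ is defined at each $(w_1,w_2)$ by $$(f\circledcirc g)_{j,k}=f_{j,k}g_{j,k}-w_1\sum_{l\ne j}\sigma_{1,jl}(f_{j,k}-f_{l,k})(g_{j,k}-g_{l,k})-w_2\sum_{m\neq k}\sigma_{2,km}(f_{j,k}-f_{j,m})(g_{j,k}-g_{j,m})$$ $$\quad+w_1w_2\sum_{l\ne j,\,m\ne k}\sigma_{1,jl}\sigma_{2,km}\big((f_{j,k}-f_{j,m})-(f_{l,k}-f_{l,m})\big)\big((g_{j,k}-g_{j,m})-(g_{l,k}-g_{l,m})\big),$$ where all components are evaluated at $(w_1,w_2)$. $C_{\Lambda_1\times\Lambda_2}(M_1\times M_2)$ denotes the space $C(M_1\times M_2,\mathbb{C}^{d_1\times d_2})$ of continuous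 functions with product $\circledcirc$ and norm $\|f\|=\sup_{|g|_\infty\le1}|f\circledcirc g|_\infty$, where $|f|_\infty=\max_{j,k}\max_{M_1\times M_2}|f_{j,k}|$; it is a commutative unital Banach algebra whose unit is the constant function with all components equal to $1$. A character is a nonzero multiplicative linear functional $X\to\mathbb{C}$. *)

theory Defs
  imports
    "HOL-Analysis.Analysis"
    "HOL-Computational_Algebra.Polynomial"
    "HOL-Algebra.Module"
begin

(* A d-element index set {1..d} is rendered as a finite type with CARD = d; the roots of p are
   enumerated by a function lam on that type. Matrices in C^(d1 x d2) have type complex^'n^'m,
   with rows indexed by 'm (d1 = CARD('m)) and columns by 'n (d2 = CARD('n)). *)

definition enumerates_roots :: "complex poly \<Rightarrow> ('i::finite \<Rightarrow> complex) \<Rightarrow> bool" where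
  "enumerates_roots p lam \<longleftrightarrow> inj lam \<and> range lam = {z. poly p z = 0}"

(* The division is by polynomials and exact, since lam j is a root of p. The pointwise quotient
   poly p z / (z - lam j) would be 0 at z = lam j in HOL, where the Lagrange polynomial is 1. *)
definition lagrange :: "complex poly \<Rightarrow> ('i::finite \<Rightarrow> complex) \<Rightarrow> 'i \<Rightarrow> complex poly" where
  "lagrange p lam j = Polynomial.smult (1 / poly (pderiv p) (lam j)) (p div [:- lam j, 1:])"

definition sigma_coeff :: "complex poly \<Rightarrow> ('i::finite \<Rightarrow> complex) \<Rightarrow> 'i \<Rightarrow> 'i \<Rightarrow> complex" where
  "sigma_coeff p lam j l = 1 / poly (pderiv p) (lam l) * (1 / (lam j - lam l))"

definition polyprod_at ::
  "complex poly \<Rightarrow> ('m::finite \<Rightarrow> complex) \<Rightarrow> complex poly \<Rightarrow> ('n::finite \<Rightarrow> complex) \<Rightarrow>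
   complex \<times> complex \<Rightarrow> complex^'n^'m \<Rightarrow> complex^'n^'m \<Rightarrow> complex^'n^'m" where
  "polyprod_at p1 lam p2 mu w F G = (\<chi> j k.
     F$j$k * G$j$k
     - fst w * (\<Sum>l\<in>UNIV - {j}. sigma_coeff p1 lam j l * (F$j$k - F$l$k) * (G$j$k - G$l$k))
     - snd w * (\<Sum>m\<in>UNIV - {k}. sigma_coeff p2 mu k m * (F$j$k - F$j$m) * (G$j$k - G$j$m))
     + fst w * snd w * (\<Sum>l\<in>UNIV - {j}. \<Sum>m\<in>UNIV - {k}.
         sigma_coeff p1 lam j l * sigma_coeff p2 mu k m
           * ((F$j$k - F$j$m) - (F$l$k - F$l$m))
           * ((G$j$k - G$j$m) - (G$l$k - G$l$m))))"

(* Functions on S are represented as in FuncSet: extensional, i.e. undefined off S. *)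
definition cont_funs :: "(complex \<times> complex) set \<Rightarrow> (complex \<times> complex \<Rightarrow> complex^'n::finite^'m::finite) set" where
  "cont_funs S = {f \<in> extensional S. continuous_on S f}"

definition polyprod ::
  "complex poly \<Rightarrow> ('m::finite \<Rightarrow> complex) \<Rightarrow> complex poly \<Rightarrow> ('n::finite \<Rightarrow> complex) \<Rightarrow>
   (complex \<times> complex) set \<Rightarrow>
   (complex \<times> complex \<Rightarrow> complex^'n^'m) \<Rightarrow> (complex \<times> complex \<Rightarrow> complex^'n^'m) \<Rightarrow>
   (complex \<times> complex \<Rightarrow> complex^'n^'m)" where
  "polyprod p1 lam p2 mu S f g = (\<lambda>w\<in>S. polyprod_at p1 lam p2 mu w (f w) (g w))"

(* The inserted 0 matters only for empty S, where Sup {} is unspecified on the reals. *)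
definition sup_norm :: "(complex \<times> complex) set \<Rightarrow> (complex \<times> complex \<Rightarrow> complex^'n::finite^'m::finite) \<Rightarrow> real" where
  "sup_norm S f = Sup (insert 0 {cmod (f w $ j $ k) | w j k. w \<in> S})"

record 'a normed_calgebra = "(complex, 'a) module" +
  alg_norm :: "'a \<Rightarrow> real"

definition C_alg ::
  "complex poly \<Rightarrow> ('m::finite \<Rightarrow> complex) \<Rightarrow> complex poly \<Rightarrow> ('n::finite \<Rightarrow> complex) \<Rightarrow>
   complex set \<Rightarrow> complex set \<Rightarrow> (complex \<times> complex \<Rightarrow> complex^'n^'m) normed_calgebra" where
  "C_alg p1 lam p2 mu M1 M2 =
    \<lparr> carrier = cont_funs (M1 \<times> M2),
      mult = polyprod p1 lam p2 mu (M1 \<times> M2),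
      one = (\<lambda>w\<in>M1 \<times> M2. \<chi> j k. 1),
      zero = (\<lambda>w\<in>M1 \<times> M2. 0),
      add = (\<lambda>f g. \<lambda>w\<in>M1 \<times> M2. f w + g w),
      smult = (\<lambda>c f. \<lambda>w\<in>M1 \<times> M2. \<chi> j k. c * f w $ j $ k),
      alg_norm = (\<lambda>f. SUP g\<in>{g \<in> cont_funs (M1 \<times> M2). sup_norm (M1 \<times> M2) g \<le> 1}.
        sup_norm (M1 \<times> M2) (polyprod p1 lam p2 mu (M1 \<times> M2) f g)) \<rparr>"

(* Purely algebraic: continuity of a character is not part of the definition. *)
definition characters :: "'a normed_calgebra \<Rightarrow> ('a \<Rightarrow> complex) set" where
  "characters A = {\<phi> \<in> extensional (carrier A).
     (\<forall>x\<in>carrier A. \<forall>y\<in>carrier A. \<phi> (x \<oplus>\<^bsub>A\<^esub> y) = \<phi> x + \<phi> y) \<and>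
     (\<forall>c. \<forall>x\<in>carrier A. \<phi> (c \<odot>\<^bsub>A\<^esub> x) = c * \<phi> x) \<and>
     (\<forall>x\<in>carrier A. \<forall>y\<in>carrier A. \<phi> (x \<otimes>\<^bsub>A\<^esub> y) = \<phi> x * \<phi> y) \<and>
     (\<exists>x\<in>carrier A. \<phi> x \<noteq> 0)}"

definition char_eval ::
  "complex poly \<Rightarrow> ('m::finite \<Rightarrow> complex) \<Rightarrow> complex poly \<Rightarrow> ('n::finite \<Rightarrow> complex) \<Rightarrow>
   complex set \<Rightarrow> complex set \<Rightarrow> complex \<times> complex \<Rightarrow>
   (complex \<times> complex \<Rightarrow> complex^'n^'m) \<Rightarrow> complex" where
  "char_eval p1 lam p2 mu M1 M2 z =
     (\<lambda>f\<in>carrier (C_alg p1 lam p2 mu M1 M2).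
        \<Sum>j\<in>UNIV. \<Sum>k\<in>UNIV.
          poly (lagrange p1 lam j) (fst z) * poly (lagrange p2 mu k) (snd z)
            * f (poly p1 (fst z), poly p2 (snd z)) $ j $ k)"

end

(* For w = p(z) the numbers e_j = delta_j(z) have sum 1 and satisfy
   e_j e_l = w (sigma_jl e_j + sigma_lj e_l) for j \<noteq> l, and these relations alone make
   evaluation at z multiplicative. Conversely, every solution e arises from some z with p(z) = w.
   A character restricts to a point evaluation at some (w_1, w_2) on the scalar functions, so it is
   determined by its values on the constant matrix units, which are products of a row indicator and
   a column indicator. The indicators multiply by the relations above, so their values are
   delta_{1,j}(z_1) and delta_{2,k}(z_2) with p_1(z_1) = w_1 and p_2(z_2) = w_2. *)

theory Submission
  imports Defs
begin

section \<open>The product on a fiber, in one and in two variables\<close>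

text \<open>For \<open>p\<close> monic with simple roots listed by \<open>lam\<close>, this is
  multiplication in C[z]/(p(z) - w), in coordinates with respect to the Lagrange basis.\<close>

definition fiber_prod ::
  "complex poly \<Rightarrow> ('i::finite \<Rightarrow> complex) \<Rightarrow> complex \<Rightarrow> ('i \<Rightarrow> complex) \<Rightarrow> ('i \<Rightarrow> complex) \<Rightarrow> 'i \<Rightarrow> complex" where
  "fiber_prod p lam w a b j =
     a j * b j - w * (\<Sum>l\<in>UNIV - {j}. sigma_coeff p lam j l * (a j - a l) * (b j - b l))"

text \<open>The conditions for a -> sum of e_j a_j to be unital and multiplicative for
  \<open>fiber_prod\<close>; the relations express multiplicativity on two distinct
  indicators.\<close>

definition fiber_weights ::
  "complex poly \<Rightarrow> ('i::finite \<Rightarrow> complex) \<Rightarrow> complex \<Rightarrow> ('i \<Rightarrow> complex) \<Rightarrow> bool" where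
  "fiber_weights p lam w e \<longleftrightarrow> (\<Sum>j\<in>UNIV. e j) = 1 \<and>
     (\<forall>j l. j \<noteq> l \<longrightarrow> e j * e l = w * (sigma_coeff p lam j l * e j + sigma_coeff p lam l j * e l))"

text \<open>The covariance of \<open>a\<close> and \<open>b\<close> under the weights is half the
  double sum of \<open>e j * e l * ?d j l\<close>, because the weights sum to 1. By the relations
  and the symmetry of \<open>?d\<close>, the same double sum is twice the weighted correction term
  of the product.\<close>

lemma sum_fiber_prod:
  assumes "fiber_weights p lam w e"
  shows "(\<Sum>j\<in>UNIV. e j * fiber_prod p lam w a b j)
    = (\<Sum>j\<in>UNIV. e j * a j) * (\<Sum>j\<in>UNIV. e j * b j)"
proof -
  let ?s = "sigma_coeff p lam"
  let ?d = "\<lambda>j l. (a j - a l) * (b j - b l)"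
  have sum1: "(\<Sum>j\<in>UNIV. e j) = 1"
    and rel: "\<And>j l. j \<noteq> l \<Longrightarrow> e j * e l = w * (?s j l * e j + ?s l j * e l)"
    using assms by (auto simp: fiber_weights_def)
  \<comment> \<open>The diagonal term vanishes, so the sum may run over all indices and be
    symmetrized.\<close>
  have fp: "fiber_prod p lam w a b j = a j * b j - w * (\<Sum>l\<in>UNIV. ?s j l * ?d j l)" for j
    unfolding fiber_prod_def by (subst sum.remove[of UNIV j]) (simp_all add: mult.assoc)
  have left: "(\<Sum>j\<in>UNIV. e j * fiber_prod p lam w a b j) =
      (\<Sum>j\<in>UNIV. e j * a j * b j) - (\<Sum>j\<in>UNIV. \<Sum>l\<in>UNIV. w * ?s j l * e j * ?d j l)"
    by (simp add: fp right_diff_distrib sum_subtractf sum_distrib_left mult_ac)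
  have "(\<Sum>j\<in>UNIV. \<Sum>l\<in>UNIV. e j * e l * ?d j l) =
      (\<Sum>j\<in>UNIV. \<Sum>l\<in>UNIV. e j * a j * b j * e l) - (\<Sum>j\<in>UNIV. \<Sum>l\<in>UNIV. e j * a j * (e l * b l))
    - (\<Sum>j\<in>UNIV. \<Sum>l\<in>UNIV. e j * b j * (e l * a l)) + (\<Sum>j\<in>UNIV. \<Sum>l\<in>UNIV. e j * (e l * a l * b l))"
    by (simp add: algebra_simps sum.distrib sum_subtractf)
  also have "\<dots> = 2 * ((\<Sum>j\<in>UNIV. e j * a j * b j) - (\<Sum>j\<in>UNIV. e j * a j) * (\<Sum>j\<in>UNIV. e j * b j))"
    by (simp add: sum_product[symmetric] sum_distrib_left[symmetric] sum_distrib_right[symmetric] sum1)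
  finally have A: "(\<Sum>j\<in>UNIV. \<Sum>l\<in>UNIV. e j * e l * ?d j l) = \<dots>" .
  have "e j * e l * ?d j l = w * ?s j l * e j * ?d j l + w * ?s l j * e l * ?d l j" for j l
    by (cases "j = l") (simp_all add: rel algebra_simps)
  then have "(\<Sum>j\<in>UNIV. \<Sum>l\<in>UNIV. e j * e l * ?d j l) =
      (\<Sum>j\<in>UNIV. \<Sum>l\<in>UNIV. w * ?s j l * e j * ?d j l)
    + (\<Sum>j\<in>UNIV. \<Sum>l\<in>UNIV. w * ?s l j * e l * ?d l j)"
    by (simp only: sum.distrib)
  also have "(\<Sum>j\<in>UNIV. \<Sum>l\<in>UNIV. w * ?s l j * e l * ?d l j) =
      (\<Sum>j\<in>UNIV. \<Sum>l\<in>UNIV. w * ?s j l * e j * ?d j l)"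
    by (rule sum.swap)
  finally have B: "(\<Sum>j\<in>UNIV. \<Sum>l\<in>UNIV. e j * e l * ?d j l) =
      2 * (\<Sum>j\<in>UNIV. \<Sum>l\<in>UNIV. w * ?s j l * e j * ?d j l)" by simp
  then have "2 * (\<Sum>j\<in>UNIV. \<Sum>l\<in>UNIV. w * ?s j l * e j * ?d j l) =
      2 * ((\<Sum>j\<in>UNIV. e j * a j * b j) - (\<Sum>j\<in>UNIV. e j * a j) * (\<Sum>j\<in>UNIV. e j * b j))"
    using A by metis
  then have "(\<Sum>j\<in>UNIV. \<Sum>l\<in>UNIV. w * ?s j l * e j * ?d j l) =
      (\<Sum>j\<in>UNIV. e j * a j * b j) - (\<Sum>j\<in>UNIV. e j * a j) * (\<Sum>j\<in>UNIV. e j * b j)"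
    unfolding mult_cancel_left by simp
  then show ?thesis unfolding left by simp
qed

(* The two-variable product is the tensor product of the one-variable products. *)
lemma polyprod_at_fiber_prod:
  "polyprod_at p1 lam p2 mu w F G $ j $ k =
     fiber_prod p2 mu (snd w) (\<lambda>k. F$j$k) (\<lambda>k. G$j$k) k
     - fst w * (\<Sum>l\<in>UNIV - {j}. sigma_coeff p1 lam j l *
         fiber_prod p2 mu (snd w) (\<lambda>k. F$j$k - F$l$k) (\<lambda>k. G$j$k - G$l$k) k)"
proof -
  \<comment> \<open>This regroups the mixed difference: the column difference of row
    \<open>j\<close> minus that of row \<open>l\<close> is a column difference of the difference of
    the rows.\<close>
  have "((a::complex) - b) - (c - d) = (a - c) - (b - d)" for a b c d by simp
  then show ?thesis
    unfolding polyprod_at_def fiber_prod_def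
    by (simp add: algebra_simps sum_subtractf sum.distrib sum_distrib_left)
qed

text \<open>Weighting the columns by \<open>e'\<close> is multiplicative on each row and on each
  difference of rows, which leaves the one-variable product of the row values. Weighting the rows by
  \<open>e\<close> then finishes.\<close>

lemma sum_polyprod_at:
  assumes e: "fiber_weights p1 lam (fst w) e" and e': "fiber_weights p2 mu (snd w) e'"
  shows "(\<Sum>j\<in>UNIV. \<Sum>k\<in>UNIV. e j * e' k * polyprod_at p1 lam p2 mu w F G $ j $ k)
    = (\<Sum>j\<in>UNIV. \<Sum>k\<in>UNIV. e j * e' k * F $ j $ k) * (\<Sum>j\<in>UNIV. \<Sum>k\<in>UNIV. e j * e' k * G $ j $ k)"
proof -
  let ?U = "\<lambda>j. \<Sum>k\<in>UNIV. e' k * F $ j $ k" and ?V = "\<lambda>j. \<Sum>k\<in>UNIV. e' k * G $ j $ k"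
  have row: "(\<Sum>k\<in>UNIV. e' k * polyprod_at p1 lam p2 mu w F G $ j $ k) =
      fiber_prod p1 lam (fst w) ?U ?V j" for j
  proof -
    have "(\<Sum>k\<in>UNIV. e' k * polyprod_at p1 lam p2 mu w F G $ j $ k) =
      (\<Sum>k\<in>UNIV. e' k * fiber_prod p2 mu (snd w) (\<lambda>k. F$j$k) (\<lambda>k. G$j$k) k)
     - fst w * (\<Sum>k\<in>UNIV. \<Sum>l\<in>UNIV - {j}. sigma_coeff p1 lam j l *
         (e' k * fiber_prod p2 mu (snd w) (\<lambda>k. F$j$k - F$l$k) (\<lambda>k. G$j$k - G$l$k) k))"
      by (simp add: polyprod_at_fiber_prod right_diff_distrib sum_subtractf sum_distrib_left mult_ac)
    also have "\<dots> = (\<Sum>k\<in>UNIV. e' k * fiber_prod p2 mu (snd w) (\<lambda>k. F$j$k) (\<lambda>k. G$j$k) k)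
     - fst w * (\<Sum>l\<in>UNIV - {j}. sigma_coeff p1 lam j l *
         (\<Sum>k\<in>UNIV. e' k * fiber_prod p2 mu (snd w) (\<lambda>k. F$j$k - F$l$k) (\<lambda>k. G$j$k - G$l$k) k))"
      by (subst sum.swap) (simp add: sum_distrib_left)
    also have "\<dots> = fiber_prod p1 lam (fst w) ?U ?V j"
      unfolding sum_fiber_prod[OF e']
      unfolding fiber_prod_def right_diff_distrib[of "e' _"] sum_subtractf mult.assoc ..
    finally show ?thesis .
  qed
  show ?thesis
    using sum_fiber_prod[OF e, of ?U ?V] unfolding row[symmetric]
    by (simp add: sum_distrib_left mult.assoc)
qed

section \<open>Polyproducts of constant, row and column matrices\<close>

text \<open>All differences of a constant matrix vanish. Applied pointwise, this makes scalar
  functions act by ordinary scaling.\<close>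

lemma polyprod_at_const_left:
  "polyprod_at p1 lam p2 mu w (\<chi> j k. c) G = (\<chi> j k. c * G $ j $ k)"
  by (simp add: polyprod_at_def)

text \<open>Column differences of the first factor and row differences of the second vanish, which
  kills every correction term. Hence matrix units are products of indicators.\<close>

lemma polyprod_at_row_column:
  "polyprod_at p1 lam p2 mu w (\<chi> j k. a j) (\<chi> j k. b k) = (\<chi> j k. a j * b k)"
  by (simp add: polyprod_at_def)

lemma polyprod_at_rows:
  "polyprod_at p1 lam p2 mu w (\<chi> j k. a j) (\<chi> j k. b j) = (\<chi> j k. fiber_prod p1 lam (fst w) a b j)"
  by (simp add: polyprod_at_def fiber_prod_def)

lemma polyprod_at_columns:
  "polyprod_at p1 lam p2 mu w (\<chi> j k. a k) (\<chi> j k. b k) = (\<chi> j k. fiber_prod p2 mu (snd w) a b k)"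
  by (simp add: polyprod_at_def fiber_prod_def)

text \<open>The pointwise product is zero. At \<open>i = j\<close> only the term of \<open>l\<close>
  survives, with differences 1 and -1, and symmetrically at \<open>i = l\<close>. The result is the
  relation in \<open>fiber_weights\<close> with indicators for weights.\<close>

lemma fiber_prod_indicators:
  assumes "j \<noteq> l"
  shows "fiber_prod p lam w (\<lambda>i. of_bool (i = j)) (\<lambda>i. of_bool (i = l)) i =
    w * sigma_coeff p lam j l * of_bool (i = j) + w * sigma_coeff p lam l j * of_bool (i = l)"
proof -
  consider "i = j" | "i = l" "i \<noteq> j" | "i \<noteq> j" "i \<noteq> l" by blast
  then show ?thesis
  proof cases
    case 1
    have "(\<Sum>n\<in>UNIV - {j}. sigma_coeff p lam j n * (1 - of_bool (n = j)) * (of_bool (j = l) - of_bool (n = l)))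
      = (\<Sum>n\<in>UNIV - {j}. if n = l then - sigma_coeff p lam j l else 0)"
      by (rule sum.cong) (use assms in auto)
    then show ?thesis using 1 assms by (simp add: fiber_prod_def)
  next
    case 2
    have "(\<Sum>n\<in>UNIV - {l}. sigma_coeff p lam l n * (of_bool (l = j) - of_bool (n = j)) * (1 - of_bool (n = l)))
      = (\<Sum>n\<in>UNIV - {l}. if n = j then - sigma_coeff p lam l j else 0)"
      by (rule sum.cong) (use assms in auto)
    then show ?thesis using 2 assms by (simp add: fiber_prod_def)
  next
    case 3
    have "(\<Sum>n\<in>UNIV - {i}. sigma_coeff p lam i n * (of_bool (i = j) - of_bool (n = j)) * (of_bool (i = l) - of_bool (n = l)))
      = 0"
      by (rule sum.neutral) (use assms 3 in auto)
    then show ?thesis using 3 assms by (simp add: fiber_prod_def)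
  qed
qed

section \<open>Lagrange interpolation at simple roots\<close>

text \<open>The roots are simple because \<open>lam\<close> lists as many distinct ones as the
  degree.\<close>

locale monic_simple_roots =
  fixes p :: "complex poly" and lam :: "'i::finite \<Rightarrow> complex"
  assumes monic: "lead_coeff p = 1"
    and degree_eq: "degree p = CARD('i)"
    and roots: "enumerates_roots p lam"
begin

lemma inj_lam: "inj lam" and root_iff: "poly p z = 0 \<longleftrightarrow> z \<in> range lam"
  using roots by (auto simp: enumerates_roots_def)

lemma lam_eq_iff [simp]: "lam j = lam l \<longleftrightarrow> j = l"
  using inj_lam by (auto dest: injD)

lemma poly_lam [simp]: "poly p (lam j) = 0"
  by (simp add: root_iff)

lemma eq_if_eq_on_roots:
  assumes "degree q < CARD('i)" "degree r < CARD('i)" "\<And>j. poly q (lam j) = poly r (lam j)"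
  shows "q = r"
proof (rule poly_eqI_degree[of "range lam"])
  show "degree q < card (range lam)" "degree r < card (range lam)"
    using assms by (simp_all add: card_image inj_lam)
qed (use assms in auto)

text \<open>Both sides are monic of the same degree, so the difference has smaller degree, yet it
  vanishes at all the roots.\<close>

lemma p_eq_prod: "p = (\<Prod>j\<in>UNIV. [:- lam j, 1:])"
proof (rule ccontr)
  let ?q = "\<Prod>j\<in>UNIV. [:- lam j, 1:]"
  assume ne: "p \<noteq> ?q"
  have dq: "degree ?q = CARD('i)" by (simp add: degree_prod_eq_sum_degree)
  have lq: "lead_coeff ?q = 1" by (simp add: lead_coeff_prod)
  have pos: "CARD('i) > 0" by simp
  have "degree (p - ?q) < CARD('i)"
    using degree_diff_le_max[of p ?q] monic degree_eq dq lq pos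
    by (metis (no_types, lifting) coeff_diff diff_self eq_iff_diff_eq_0 le_degree leading_coeff_0_iff max.idem ne order_le_less)
  then have "p - ?q = 0"
    by (rule eq_if_eq_on_roots) (simp_all add: poly_prod prod_zero)
  with ne show False by simp
qed

lemma p_factor: "p = [:- lam j, 1:] * (\<Prod>l\<in>UNIV - {j}. [:- lam l, 1:])"
  by (subst p_eq_prod) (simp add: prod.remove)

lemma div_factor: "p div [:- lam j, 1:] = (\<Prod>l\<in>UNIV - {j}. [:- lam l, 1:])"
  by (subst p_factor[of j]) (rule nonzero_mult_div_cancel_left, simp)

lemma pderiv_lam:
  "poly (pderiv p) (lam j) = poly (p div [:- lam j, 1:]) (lam j)"
proof -
  have "pderiv p = pderiv ([:- lam j, 1:] * (p div [:- lam j, 1:]))"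
    unfolding div_factor using p_factor[of j] by simp
  also have "poly \<dots> (lam j) = poly (p div [:- lam j, 1:]) (lam j)"
    by (simp add: pderiv_mult pderiv_pCons del: mult_pCons_left)
  finally show ?thesis .
qed

lemma pderiv_lam_nonzero [simp]: "poly (pderiv p) (lam j) \<noteq> 0"
  unfolding pderiv_lam div_factor by (simp add: poly_prod)

lemma lagrange_lam: "poly (lagrange p lam j) (lam l) = of_bool (j = l)"
proof (cases "j = l")
  case True
  then show ?thesis
    using pderiv_lam_nonzero[of l] by (simp add: lagrange_def pderiv_lam[of l])
next
  case False
  then show ?thesis by (auto simp: lagrange_def div_factor poly_prod)
qed

text \<open>The quotient formula is cleared of the denominator \<open>z - lam j\<close> so that it
  holds at the root too.\<close>

lemma lagrange_mult: "poly (lagrange p lam j) z * (z - lam j) = poly p z / poly (pderiv p) (lam j)"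
proof -
  have "poly p z = (z - lam j) * poly (p div [:- lam j, 1:]) z"
    unfolding div_factor by (subst p_factor[of j]) (simp add: algebra_simps)
  then show ?thesis by (simp add: lagrange_def)
qed

text \<open>The sum has degree below the number of roots and equals 1 at each of them.\<close>

lemma sum_lagrange: "(\<Sum>j\<in>UNIV. poly (lagrange p lam j) z) = 1"
proof -
  have "degree (lagrange p lam j) \<le> CARD('i) - 1" for j
    by (simp add: lagrange_def div_factor degree_prod_eq_sum_degree)
  then have "degree (\<Sum>j\<in>UNIV. lagrange p lam j) \<le> CARD('i) - 1"
    by (intro degree_sum_le) auto
  \<comment> \<open>The bound becomes strict because the index type is nonempty.\<close>
  then have "degree (\<Sum>j\<in>UNIV. lagrange p lam j) < CARD('i)"
    by (metis One_nat_def Suc_pred le_imp_less_Suc zero_less_card_finite)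
  then have "(\<Sum>j\<in>UNIV. lagrange p lam j) = 1"
    by (rule eq_if_eq_on_roots) (simp_all add: poly_sum lagrange_lam)
  then show ?thesis by (metis poly_1 poly_sum)
qed

text \<open>Off the roots this is the partial fraction expansion of 1 / ((z - lam j) (z - lam l)).
  At a root, \<open>poly p z\<close> is zero and so is at least one of the two Lagrange
  values.\<close>

lemma fiber_weights_lagrange:
  "fiber_weights p lam (poly p z) (\<lambda>j. poly (lagrange p lam j) z)"
  unfolding fiber_weights_def
proof (intro conjI allI impI sum_lagrange)
  fix j l :: 'i
  assume jl: "j \<noteq> l"
  show "poly (lagrange p lam j) z * poly (lagrange p lam l) z =
    poly p z * (sigma_coeff p lam j l * poly (lagrange p lam j) z
      + sigma_coeff p lam l j * poly (lagrange p lam l) z)"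
  proof (cases "poly p z = 0")
    case True
    then show ?thesis using jl by (auto simp: root_iff lagrange_lam)
  next
    case False
    then have ne: "z \<noteq> lam i" for i by auto
    have eq: "poly (lagrange p lam i) z = poly p z / (poly (pderiv p) (lam i) * (z - lam i))" for i
      using lagrange_mult[of i z] ne[of i] by (simp add: field_simps)
    have d: "lam j - lam l \<noteq> 0" "lam l - lam j \<noteq> 0" "z - lam j \<noteq> 0" "z - lam l \<noteq> 0"
      using jl ne by auto
    show ?thesis
      unfolding eq sigma_coeff_def using d pderiv_lam_nonzero[of j] pderiv_lam_nonzero[of l]
      by (simp add: divide_simps) (simp add: algebra_simps)
  qed
qed

text \<open>Clearing denominators and summing over one index yields \<open>lagrange_mult\<close>
  with \<open>w\<close> for \<open>poly p z\<close> and \<open>e\<close> for the Lagrange values. If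
  \<open>w\<close> is nonzero, the weights are then proportional to the Lagrange values at
  \<open>z\<close>, and both families sum to 1.\<close>

lemma fiber_weights_imp_lagrange:
  assumes "fiber_weights p lam w e"
  obtains z where "poly p z = w" "\<And>j. e j = poly (lagrange p lam j) z"
proof -
  let ?c = "\<lambda>j. 1 / poly (pderiv p) (lam j)"
  have sum1: "(\<Sum>j\<in>UNIV. e j) = 1"
    and rel: "\<And>j l. j \<noteq> l \<Longrightarrow> e j * e l = w * (sigma_coeff p lam j l * e j + sigma_coeff p lam l j * e l)"
    using assms by (auto simp: fiber_weights_def)
  \<comment> \<open>This form also holds for \<open>j = l\<close>, so it can be summed over all
    \<open>j\<close>.\<close>
  have rel': "(lam j - lam l) * (e j * e l) = w * (?c l * e j - ?c j * e l)" for j l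
  proof (cases "j = l")
    case False
    then have d: "lam j - lam l \<noteq> 0" by auto
    have "1 / (lam l - lam j) = - (1 / (lam j - lam l))"
      by (metis minus_diff_eq minus_divide_right)
    then have s1: "sigma_coeff p lam l j = - (?c j / (lam j - lam l))"
      by (simp only: sigma_coeff_def) simp
    have s2: "sigma_coeff p lam j l = ?c l / (lam j - lam l)"
      by (simp add: sigma_coeff_def)
    have "x * (w * (y / x * a + - (z / x) * b)) = w * (y * a - z * b)"
      if "x \<noteq> 0" for x y z a b :: complex
      using that by (simp add: field_simps)
    from this[OF d] show ?thesis unfolding rel[OF False] s1 s2 .
  qed simp
  (* For CARD('i) > 1 the sum of the ?c j is 0, and z is the interpolation of the identity at the
     roots. For CARD('i) = 1 it is 1, and z = lam + w. *)
  define z where "z = (\<Sum>j\<in>UNIV. lam j * e j) + w * (\<Sum>j\<in>UNIV. ?c j)"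
  have z: "(z - lam l) * e l = w * ?c l" for l
  proof -
    have "(\<Sum>j\<in>UNIV. (lam j - lam l) * (e j * e l)) = (\<Sum>j\<in>UNIV. w * (?c l * e j - ?c j * e l))"
      by (simp only: rel')
    then have "(\<Sum>j\<in>UNIV. lam j * e j) * e l - lam l * (\<Sum>j\<in>UNIV. e j) * e l =
        w * ?c l * (\<Sum>j\<in>UNIV. e j) - w * (\<Sum>j\<in>UNIV. ?c j) * e l"
      by (simp add: algebra_simps sum_subtractf sum_distrib_left sum_distrib_right sum_divide_distrib)
    then show ?thesis unfolding z_def sum1 by (simp add: algebra_simps)
  qed
  show thesis
  proof (cases "w = 0")
    case True
    \<comment> \<open>Every (z - lam l) * e l is now zero: a nonzero weight identifies
      \<open>z\<close> with its root, and the other weights vanish.\<close>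
    obtain l where l: "e l \<noteq> 0" using sum1 by (metis sum.neutral zero_neq_one)
    then have zl: "z = lam l" using z[of l] True by auto
    have e0: "e j = 0" if "j \<noteq> l" for j using z[of j] True zl that by auto
    have "(\<Sum>j\<in>UNIV. e j) = e l"
      by (subst sum.remove[of _ l]) (auto simp: e0)
    then have "e j = of_bool (j = l)" for j using e0 sum1 by auto
    then show thesis using zl True that[of z] by (simp add: lagrange_lam)
  next
    case False
    have ne: "z - lam l \<noteq> 0" for l using z[of l] False by auto
    then have e: "e l = w * ?c l / (z - lam l)" for l using z[of l] by (simp add: field_simps)
    have lag: "poly (lagrange p lam l) z = poly p z * ?c l / (z - lam l)" for l
      using lagrange_mult[of l z] ne[of l] by (simp add: field_simps)
    have wl: "w * poly (lagrange p lam l) z = poly p z * e l" for l by (simp add: e lag)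
    have "w * (\<Sum>l\<in>UNIV. poly (lagrange p lam l) z) = poly p z * (\<Sum>l\<in>UNIV. e l)"
      unfolding sum_distrib_left wl ..
    then have "poly p z = w" by (simp add: sum_lagrange sum1)
    then show thesis using that[of z] by (simp add: e lag)
  qed
qed

end

section \<open>Characters of the continuous functions on a compact set\<close>

text \<open>If no point fits, compactness combines kernel elements into one without zeros on
  \<open>K\<close>, but a proper ideal contains no invertible element. The assumption
  \<open>cong\<close> lets total functions stand for functions on \<open>K\<close>.\<close>

lemma character_of_continuous_functions:
  fixes K :: "'a::topological_space set" and \<psi> :: "('a \<Rightarrow> complex) \<Rightarrow> complex"
  assumes K: "compact K"
    and cong: "\<And>h h'. (\<And>w. w \<in> K \<Longrightarrow> h w = h' w) \<Longrightarrow> \<psi> h = \<psi> h'"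
    and add: "\<And>h h'. \<lbrakk>continuous_on K h; continuous_on K h'\<rbrakk> \<Longrightarrow> \<psi> (\<lambda>w. h w + h' w) = \<psi> h + \<psi> h'"
    and mult: "\<And>h h'. \<lbrakk>continuous_on K h; continuous_on K h'\<rbrakk> \<Longrightarrow> \<psi> (\<lambda>w. h w * h' w) = \<psi> h * \<psi> h'"
    and const: "\<And>c. \<psi> (\<lambda>w. c) = c"
  obtains w where "w \<in> K" "\<And>h. continuous_on K h \<Longrightarrow> \<psi> h = h w"
proof (rule ccontr)
  assume "\<not> thesis"
  then have "\<exists>h. continuous_on K h \<and> \<psi> h \<noteq> h w" if "w \<in> K" for w using \<open>w \<in> K\<close> \<open>\<And>w. \<lbrakk>w \<in> K; \<And>h. continuous_on K h \<Longrightarrow> \<psi> h = h w\<rbrakk> \<Longrightarrow> thesis\<close> by blast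
  then obtain g where g: "\<And>w. w \<in> K \<Longrightarrow> continuous_on K (g w) \<and> \<psi> (g w) \<noteq> g w w" by metis
  \<comment> \<open>Subtracting the constant \<open>\<psi> (g w)\<close> moves \<open>g w\<close>
    into the kernel and keeps it nonzero at \<open>w\<close>.\<close>
  define h where "h w x = g w x + (- \<psi> (g w))" for w x
  have h: "continuous_on K (h w)" "\<psi> (h w) = 0" "h w w \<noteq> 0" if "w \<in> K" for w
    using g[OF that] add[of "g w" "\<lambda>_. - \<psi> (g w)"] const
    by (auto simp: h_def[abs_def] intro!: continuous_intros)
  have "\<exists>U. open U \<and> U \<inter> K = {x \<in> K. h w x \<noteq> 0}" if "w \<in> K" for w
  proof -
    have "\<exists>U. open U \<and> U \<inter> K = h w -` (- {0}) \<inter> K"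
      using h(1)[OF that] unfolding continuous_on_open_invariant by blast
    then show ?thesis by (auto simp: set_eq_iff)
  qed
  then obtain U where U: "\<And>w. w \<in> K \<Longrightarrow> open (U w) \<and> U w \<inter> K = {x \<in> K. h w x \<noteq> 0}" by metis
  have "K \<subseteq> (\<Union>w\<in>K. U w)" using U h(3) by blast
  then obtain D where D: "D \<subseteq> K" "finite D" "K \<subseteq> (\<Union>w\<in>D. U w)"
    using compactE_image[OF K, of K U] U by metis
  (* H D is in the kernel of \<psi> but has no zero on K, so it is invertible. *)
  define H where "H E x = (\<Sum>w\<in>E. cnj (h w x) * h w x)" for E x
  have H: "\<psi> (H E) = 0 \<and> continuous_on K (H E)" if "finite E" "E \<subseteq> K" for E
    using that
  proof (induction E rule: finite_induct)
    case empty
    then show ?case using const[of 0] by (simp add: H_def[abs_def])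
  next
    case (insert w E)
    have eq: "H (insert w E) = (\<lambda>x. cnj (h w x) * h w x + H E x)"
      using insert.hyps by (simp add: H_def[abs_def])
    have c: "continuous_on K (\<lambda>x. cnj (h w x))" "continuous_on K (\<lambda>x. cnj (h w x) * h w x)"
      using insert.prems h(1) by (auto intro!: continuous_intros)
    \<comment> \<open>The factor \<open>cnj (h w x)\<close> stays inside the kernel and turns the
      summand into a squared modulus, so that summands cannot cancel.\<close>
    have "\<psi> (\<lambda>x. cnj (h w x) * h w x) = 0"
      using mult[OF c(1) h(1)] h(2) insert.prems by simp
    then show ?case unfolding eq using add[OF c(2)] insert c(2) by (auto intro!: continuous_intros)
  qed
  have ne: "H D x \<noteq> 0" if x: "x \<in> K" for x
  proof -
    obtain w where w: "w \<in> D" "h w x \<noteq> 0" using D U x by blast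
    have "H D x = of_real (\<Sum>w\<in>D. (cmod (h w x))\<^sup>2)"
      unfolding H_def of_real_sum complex_norm_square by (simp add: mult.commute)
    moreover have "(\<Sum>w\<in>D. (cmod (h w x))\<^sup>2) > 0"
      using D(2) w by (intro sum_pos2[of _ w]) auto
    ultimately show ?thesis by (metis of_real_eq_0_iff less_irrefl)
  qed
  have "1 = \<psi> (\<lambda>x. 1)" by (simp add: const)
  \<comment> \<open>Zeros of \<open>H D\<close> can lie only off \<open>K\<close>, where
    \<open>cong\<close> ignores the value of the inverse.\<close>
  also have "\<dots> = \<psi> (\<lambda>x. H D x * inverse (H D x))" by (rule cong) (simp add: ne)
  also have "\<dots> = \<psi> (H D) * \<psi> (\<lambda>x. inverse (H D x))"
    using H[OF D(2,1)] ne by (intro mult) (auto intro: continuous_on_inverse)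
  also have "\<dots> = 0" using H[OF D(2,1)] by simp
  finally show False by simp
qed

section \<open>Evaluations are characters\<close>

lemma restrict_in_cont_funs: "restrict f S \<in> cont_funs S \<longleftrightarrow> continuous_on S f"
proof -
  have "continuous_on S (restrict f S) \<longleftrightarrow> continuous_on S f"
    by (rule continuous_on_cong) simp_all
  then show ?thesis by (simp add: cont_funs_def)
qed

lemma continuous_on_polyprod_at:
  assumes "continuous_on S F" "continuous_on S G"
  shows "continuous_on S (\<lambda>w. polyprod_at p1 lam p2 mu w (F w) (G w))"
  unfolding polyprod_at_def using assms by (intro continuous_intros)

lemma char_eval_in_characters:
  fixes p1 p2 :: "complex poly"
    and lam :: "'m::finite \<Rightarrow> complex" and mu :: "'n::finite \<Rightarrow> complex"
  assumes "monic_simple_roots p1 lam" "monic_simple_roots p2 mu"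
    and z: "poly p1 z1 \<in> M1" "poly p2 z2 \<in> M2"
  shows "char_eval p1 lam p2 mu M1 M2 (z1, z2) \<in> characters (C_alg p1 lam p2 mu M1 M2)"
proof -
  interpret P: monic_simple_roots p1 lam by fact
  interpret Q: monic_simple_roots p2 mu by fact
  let ?A = "C_alg p1 lam p2 mu M1 M2" and ?S = "M1 \<times> M2"
  let ?\<chi> = "char_eval p1 lam p2 mu M1 M2 (z1, z2)"
  let ?w = "(poly p1 z1, poly p2 z2)"
  let ?e = "\<lambda>j. poly (lagrange p1 lam j) z1" and ?e' = "\<lambda>k. poly (lagrange p2 mu k) z2"
  have w: "fiber_weights p1 lam (fst ?w) ?e" "fiber_weights p2 mu (snd ?w) ?e'"
    using P.fiber_weights_lagrange Q.fiber_weights_lagrange by simp_all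
  \<comment> \<open>This functional lives on matrices at the single point \<open>?w\<close>; the
    character laws reduce to its identities.\<close>
  define L where "L F = (\<Sum>j\<in>UNIV. \<Sum>k\<in>UNIV. ?e j * ?e' k * F $ j $ k)" for F :: "complex^'n^'m"
  have L_add: "L (F + G) = L F + L G" for F G
    by (simp add: L_def algebra_simps sum.distrib)
  have L_smult: "L (\<chi> j k. c * F $ j $ k) = c * L F" for c F
    by (simp add: L_def sum_distrib_left mult_ac)
  have L_mult: "L (polyprod_at p1 lam p2 mu ?w F G) = L F * L G" for F G
    unfolding L_def by (rule sum_polyprod_at[OF w])
  have "L (\<chi> j k. 1) = (\<Sum>j\<in>UNIV. ?e j * (\<Sum>k\<in>UNIV. ?e' k))"
    by (simp add: L_def sum_distrib_left)
  then have L_one: "L (\<chi> j k. 1) = 1"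
    by (simp add: P.sum_lagrange Q.sum_lagrange)
  have carrier: "carrier ?A = cont_funs ?S" by (simp add: C_alg_def)
  have eval: "?\<chi> f = L (f ?w)" if "f \<in> cont_funs ?S" for f
    using that by (simp add: char_eval_def carrier L_def)
  \<comment> \<open>Restriction keeps the value at \<open>?w\<close>, because \<open>z\<close>
    places this point in \<open>?S\<close>.\<close>
  have eval_restrict: "?\<chi> (restrict f ?S) = L (f ?w)" if "continuous_on ?S f" for f
    using eval[of "restrict f ?S"] that z by (simp add: restrict_in_cont_funs)
  show ?thesis unfolding characters_def carrier
  proof (intro CollectI conjI ballI allI)
    show "?\<chi> \<in> extensional (cont_funs ?S)" by (simp add: char_eval_def carrier)
    have "?\<chi> (restrict (\<lambda>w. \<chi> j k. 1) ?S) \<noteq> 0"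
      using eval_restrict[of "\<lambda>w. \<chi> j k. 1"] L_one by simp
    moreover have "restrict (\<lambda>w. \<chi> j k. 1) ?S \<in> cont_funs ?S"
      by (simp add: restrict_in_cont_funs)
    ultimately show "\<exists>x\<in>cont_funs ?S. ?\<chi> x \<noteq> 0" by blast
  next
    fix f g :: "complex \<times> complex \<Rightarrow> complex^'n^'m"
    assume f: "f \<in> cont_funs ?S" and g: "g \<in> cont_funs ?S"
    then have c: "continuous_on ?S f" "continuous_on ?S g" by (simp_all add: cont_funs_def)
    have "f \<oplus>\<^bsub>?A\<^esub> g = restrict (\<lambda>w. f w + g w) ?S"
      by (simp add: C_alg_def)
    then show "?\<chi> (f \<oplus>\<^bsub>?A\<^esub> g) = ?\<chi> f + ?\<chi> g"
      using eval_restrict[OF continuous_on_add[OF c]] by (simp only: eval f g L_add)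
    have "f \<otimes>\<^bsub>?A\<^esub> g = restrict (\<lambda>w. polyprod_at p1 lam p2 mu w (f w) (g w)) ?S"
      by (simp add: C_alg_def polyprod_def)
    then show "?\<chi> (f \<otimes>\<^bsub>?A\<^esub> g) = ?\<chi> f * ?\<chi> g"
      using eval_restrict[OF continuous_on_polyprod_at[OF c]] by (simp only: eval f g L_mult)
  next
    fix c and f :: "complex \<times> complex \<Rightarrow> complex^'n^'m"
    assume f: "f \<in> cont_funs ?S"
    then have "continuous_on ?S (\<lambda>w. \<chi> j k. c * f w $ j $ k)"
      by (intro continuous_intros) (simp add: cont_funs_def)
    moreover have "c \<odot>\<^bsub>?A\<^esub> f = restrict (\<lambda>w. \<chi> j k. c * f w $ j $ k) ?S"
      by (simp add: C_alg_def)
    ultimately show "?\<chi> (c \<odot>\<^bsub>?A\<^esub> f) = c * ?\<chi> f"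
      using eval_restrict by (simp only: eval f L_smult)
  qed
qed

section \<open>Every character is an evaluation\<close>

lemma character_is_char_eval:
  fixes p1 p2 :: "complex poly"
    and lam :: "'m::finite \<Rightarrow> complex" and mu :: "'n::finite \<Rightarrow> complex"
  assumes "monic_simple_roots p1 lam" "monic_simple_roots p2 mu"
    and M: "compact M1" "compact M2"
    and phi: "\<phi> \<in> characters (C_alg p1 lam p2 mu M1 M2)"
  obtains z1 z2 where "poly p1 z1 \<in> M1" "poly p2 z2 \<in> M2" "\<phi> = char_eval p1 lam p2 mu M1 M2 (z1, z2)"
proof -
  interpret P: monic_simple_roots p1 lam by fact
  interpret Q: monic_simple_roots p2 mu by fact
  let ?A = "C_alg p1 lam p2 mu M1 M2" and ?S = "M1 \<times> M2"
  let ?C = "continuous_on ?S"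
  let ?pp = "polyprod_at p1 lam p2 mu"
  \<comment> \<open>Passing to total functions lets the algebra operations be written pointwise,
    without \<open>restrict\<close>.\<close>
  define \<Psi> where "\<Psi> F = \<phi> (restrict F ?S)" for F :: "complex \<times> complex \<Rightarrow> complex^'n^'m"
  have carr: "restrict F ?S \<in> carrier ?A" if "?C F" for F
    using that by (simp add: C_alg_def restrict_in_cont_funs)
  have \<Psi>_cong: "\<Psi> F = \<Psi> G" if "\<And>w. w \<in> ?S \<Longrightarrow> F w = G w" for F G
    unfolding \<Psi>_def using that by (metis restrict_ext)
  have \<Psi>_add: "\<Psi> (\<lambda>w. F w + G w) = \<Psi> F + \<Psi> G" if "?C F" "?C G" for F G
  proof -
    have "restrict (\<lambda>w. F w + G w) ?S = restrict F ?S \<oplus>\<^bsub>?A\<^esub> restrict G ?S"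
      by (auto simp: C_alg_def)
    then show ?thesis using phi carr that by (simp add: \<Psi>_def characters_def)
  qed
  have \<Psi>_mult: "\<Psi> (\<lambda>w. ?pp w (F w) (G w)) = \<Psi> F * \<Psi> G" if "?C F" "?C G" for F G
  proof -
    have "restrict (\<lambda>w. ?pp w (F w) (G w)) ?S = restrict F ?S \<otimes>\<^bsub>?A\<^esub> restrict G ?S"
      by (auto simp: C_alg_def polyprod_def)
    then show ?thesis using phi carr that by (simp add: \<Psi>_def characters_def)
  qed
  have \<Psi>_smult: "\<Psi> (\<lambda>w. \<chi> j k. c * F w $ j $ k) = c * \<Psi> F" if "?C F" for c F
  proof -
    have "restrict (\<lambda>w. \<chi> j k. c * F w $ j $ k) ?S = c \<odot>\<^bsub>?A\<^esub> restrict F ?S"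
      by (auto simp: C_alg_def)
    then show ?thesis using phi carr that by (simp add: \<Psi>_def characters_def)
  qed
  have \<phi>_\<Psi>: "\<phi> f = \<Psi> f" "?C f" if "f \<in> carrier ?A" for f
    using that by (auto simp: \<Psi>_def C_alg_def cont_funs_def extensional_restrict)
  \<comment> \<open>Cancelling a nonzero value of \<open>\<phi>\<close> shows that the unit goes to
    1.\<close>
  have \<Psi>_one: "\<Psi> (\<lambda>w. \<chi> j k. 1) = 1"
  proof -
    obtain f where f: "f \<in> carrier ?A" "\<phi> f \<noteq> 0" using phi by (auto simp: characters_def)
    then have "\<Psi> (\<lambda>w. \<chi> j k. 1) * \<Psi> f = \<Psi> f"
      using \<Psi>_mult[of "\<lambda>w. \<chi> j k. 1" f] \<phi>_\<Psi>[of f] by (simp add: polyprod_at_const_left)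
    then show ?thesis using f \<phi>_\<Psi> by simp
  qed
  have \<Psi>_sum: "\<Psi> (\<lambda>w. \<Sum>i\<in>I. F i w) = (\<Sum>i\<in>I. \<Psi> (F i))"
    if "finite I" "\<And>i. i \<in> I \<Longrightarrow> ?C (F i)" for F :: "'i \<Rightarrow> complex \<times> complex \<Rightarrow> complex^'n^'m" and I
    using that
  proof (induction I rule: finite_induct)
    case empty
    then show ?case using \<Psi>_smult[of "\<lambda>w. 0" 0] by (simp add: zero_vec_def)
  next
    case (insert i I)
    have "?C (\<lambda>w. \<Sum>i\<in>I. F i w)" using insert.prems by (intro continuous_intros) auto
    then show ?case using insert by (simp add: \<Psi>_add)
  qed
  \<comment> \<open>Matrices with all entries equal embed the continuous scalar functions as a
    subalgebra, and the restriction of \<open>\<Psi>\<close> to it yields the base point.\<close>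
  obtain w where w: "w \<in> ?S" and \<Psi>_scalar: "\<And>h. ?C h \<Longrightarrow> \<Psi> (\<lambda>x. \<chi> j k. h x) = h w"
  proof (rule character_of_continuous_functions[of ?S "\<lambda>h. \<Psi> (\<lambda>x. \<chi> j k. h x)"])
    show "compact ?S" using M by (rule compact_Times)
    show "\<Psi> (\<lambda>x. \<chi> j k. h x) = \<Psi> (\<lambda>x. \<chi> j k. h' x)" if "\<And>x. x \<in> ?S \<Longrightarrow> h x = h' x" for h h'
      by (rule \<Psi>_cong) (simp add: that)
    show "\<Psi> (\<lambda>x. \<chi> j k. h x + h' x) = \<Psi> (\<lambda>x. \<chi> j k. h x) + \<Psi> (\<lambda>x. \<chi> j k. h' x)" if "?C h" "?C h'" for h h'
    proof -
      have "(\<chi> (j::'m) (k::'n). h x + h' x) = (\<chi> j k. h x) + (\<chi> j k. h' x)" for x by (simp add: vec_eq_iff)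
      then show ?thesis using \<Psi>_add[of "\<lambda>x. \<chi> j k. h x" "\<lambda>x. \<chi> j k. h' x"] that
        by (simp add: continuous_intros)
    qed
    show "\<Psi> (\<lambda>x. \<chi> j k. h x * h' x) = \<Psi> (\<lambda>x. \<chi> j k. h x) * \<Psi> (\<lambda>x. \<chi> j k. h' x)" if "?C h" "?C h'" for h h'
      using \<Psi>_mult[of "\<lambda>x. \<chi> j k. h x" "\<lambda>x. \<chi> j k. h' x"] that
      by (simp add: continuous_intros polyprod_at_const_left)
    show "\<Psi> (\<lambda>x. \<chi> j k. c) = c" for c
      using \<Psi>_smult[of "\<lambda>w. \<chi> j k. 1" c] by (simp add: \<Psi>_one)
  qed blast
  \<comment> \<open>Scalar functions come out of \<open>\<Psi>\<close> as their values at
    \<open>w\<close>. In the indicator relations this replaces the variable coefficients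
    \<open>fst x\<close> and \<open>snd x\<close> by the coordinates of \<open>w\<close>.\<close>
  have \<Psi>_scale: "\<Psi> (\<lambda>x. \<chi> j k. h x * F x $ j $ k) = h w * \<Psi> F" if "?C h" "?C F" for h F
    using \<Psi>_mult[of "\<lambda>x. \<chi> j k. h x" F] that \<Psi>_scalar
    by (simp add: continuous_intros polyprod_at_const_left)
  define e where "e j = \<Psi> (\<lambda>x. \<chi> i k. of_bool (i = j))" for j
  define e' where "e' l = \<Psi> (\<lambda>x. \<chi> i k. of_bool (k = l))" for l
  have e: "fiber_weights p1 lam (fst w) e"
    unfolding fiber_weights_def
  proof (intro conjI allI impI)
    have "(\<Sum>j\<in>UNIV. e j) = \<Psi> (\<lambda>x. \<Sum>j\<in>UNIV. \<chi> i k. of_bool (i = j))"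
      unfolding e_def by (rule \<Psi>_sum[symmetric]) auto
    also have "(\<Sum>j\<in>UNIV. \<chi> (i::'m) (k::'n). of_bool (i = j)) = ((\<chi> i k. 1) :: complex^'n^'m)"
      by (simp add: vec_eq_iff)
    finally show "(\<Sum>j\<in>UNIV. e j) = 1" by (simp add: \<Psi>_one)
  next
    fix j l :: 'm
    assume jl: "j \<noteq> l"
    let ?E = "\<lambda>j. (\<chi> i k. of_bool (i = j)) :: complex^'n^'m"
    have "e j * e l = \<Psi> (\<lambda>x. ?pp x (?E j) (?E l))"
      unfolding e_def by (rule \<Psi>_mult[symmetric]) auto
    also have "\<dots> = \<Psi> (\<lambda>x. (\<chi> i k. (fst x * sigma_coeff p1 lam j l) * ?E j $ i $ k) +
        (\<chi> i k. (fst x * sigma_coeff p1 lam l j) * ?E l $ i $ k))"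
      by (rule \<Psi>_cong) (simp add: polyprod_at_rows fiber_prod_indicators[OF jl] vec_eq_iff)
    also have "\<dots> = \<Psi> (\<lambda>x. (\<chi> i k. (fst x * sigma_coeff p1 lam j l) * ?E j $ i $ k)) +
        \<Psi> (\<lambda>x. (\<chi> i k. (fst x * sigma_coeff p1 lam l j) * ?E l $ i $ k))"
      by (rule \<Psi>_add) (intro continuous_intros)+
    also have "\<dots> = fst w * sigma_coeff p1 lam j l * e j + fst w * sigma_coeff p1 lam l j * e l"
      unfolding e_def by (intro arg_cong2[of _ _ _ _ "(+)"] \<Psi>_scale continuous_intros)
    finally show "e j * e l = fst w * (sigma_coeff p1 lam j l * e j + sigma_coeff p1 lam l j * e l)"
      by (simp add: algebra_simps)
  qed
  have e': "fiber_weights p2 mu (snd w) e'"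
    unfolding fiber_weights_def
  proof (intro conjI allI impI)
    have "(\<Sum>j\<in>UNIV. e' j) = \<Psi> (\<lambda>x. \<Sum>j\<in>UNIV. \<chi> i k. of_bool (k = j))"
      unfolding e'_def by (rule \<Psi>_sum[symmetric]) auto
    also have "(\<Sum>j\<in>UNIV. \<chi> (i::'m) (k::'n). of_bool (k = j)) = ((\<chi> i k. 1) :: complex^'n^'m)"
      by (simp add: vec_eq_iff)
    finally show "(\<Sum>j\<in>UNIV. e' j) = 1" by (simp add: \<Psi>_one)
  next
    fix j l :: 'n
    assume jl: "j \<noteq> l"
    let ?E = "\<lambda>j. (\<chi> i k. of_bool (k = j)) :: complex^'n^'m"
    have "e' j * e' l = \<Psi> (\<lambda>x. ?pp x (?E j) (?E l))"
      unfolding e'_def by (rule \<Psi>_mult[symmetric]) auto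
    also have "\<dots> = \<Psi> (\<lambda>x. (\<chi> i k. (snd x * sigma_coeff p2 mu j l) * ?E j $ i $ k) +
        (\<chi> i k. (snd x * sigma_coeff p2 mu l j) * ?E l $ i $ k))"
      by (rule \<Psi>_cong) (simp add: polyprod_at_columns fiber_prod_indicators[OF jl] vec_eq_iff)
    also have "\<dots> = \<Psi> (\<lambda>x. (\<chi> i k. (snd x * sigma_coeff p2 mu j l) * ?E j $ i $ k)) +
        \<Psi> (\<lambda>x. (\<chi> i k. (snd x * sigma_coeff p2 mu l j) * ?E l $ i $ k))"
      by (rule \<Psi>_add) (intro continuous_intros)+
    also have "\<dots> = snd w * sigma_coeff p2 mu j l * e' j + snd w * sigma_coeff p2 mu l j * e' l"
      unfolding e'_def by (intro arg_cong2[of _ _ _ _ "(+)"] \<Psi>_scale continuous_intros)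
    finally show "e' j * e' l = snd w * (sigma_coeff p2 mu j l * e' j + sigma_coeff p2 mu l j * e' l)"
      by (simp add: algebra_simps)
  qed
  obtain z1 where z1: "poly p1 z1 = fst w" "\<And>j. e j = poly (lagrange p1 lam j) z1"
    by (rule P.fiber_weights_imp_lagrange[OF e]) blast
  obtain z2 where z2: "poly p2 z2 = snd w" "\<And>k. e' k = poly (lagrange p2 mu k) z2"
    by (rule Q.fiber_weights_imp_lagrange[OF e']) blast
  let ?E = "\<lambda>(j::'m) (k::'n). (\<chi> i m. of_bool (i = j) * of_bool (m = k)) :: complex^'n^'m"
  have E: "\<Psi> (\<lambda>x. ?E j k) = e j * e' k" for j k
    using \<Psi>_mult[of "\<lambda>x. \<chi> i m. of_bool (i = j)" "\<lambda>x. \<chi> i m. of_bool (m = k)"]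
    by (simp add: polyprod_at_row_column e_def e'_def)
  have "\<phi> f = char_eval p1 lam p2 mu M1 M2 (z1, z2) f" if f: "f \<in> carrier ?A" for f
  proof -
    have c: "?C (\<lambda>x. f x $ j $ k)" for j k using \<phi>_\<Psi>(2)[OF f] by (intro continuous_intros)
    \<comment> \<open>This expands \<open>f\<close> in constant matrix units with its entries as
      scalar coefficients. It holds at every point, also off \<open>?S\<close>.\<close>
    have f_eq: "f = (\<lambda>x. \<Sum>j\<in>UNIV. \<Sum>k\<in>UNIV. \<chi> i m. f x $ j $ k * ?E j k $ i $ m)"
    proof -
      \<comment> \<open>Nested conditionals let the simplifier collapse both sums.\<close>
      have "a * (of_bool (i = j) * of_bool (m = k)) = (if m = k then if i = j then a else 0 else 0)"
        for a :: complex and i j :: 'm and m k :: 'n by simp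
      then show ?thesis by (simp add: fun_eq_iff vec_eq_iff)
    qed
    have "\<phi> f = \<Psi> f" using \<phi>_\<Psi>(1)[OF f] .
    also have "\<dots> = \<Psi> (\<lambda>x. \<Sum>j\<in>UNIV. \<Sum>k\<in>UNIV. \<chi> i m. f x $ j $ k * ?E j k $ i $ m)"
      by (rule arg_cong[OF f_eq])
    also have "\<dots> = (\<Sum>j\<in>UNIV. \<Sum>k\<in>UNIV. \<Psi> (\<lambda>x. \<chi> i m. f x $ j $ k * ?E j k $ i $ m))"
      by (subst \<Psi>_sum | intro continuous_intros c sum.cong refl | simp)+
    also have "\<dots> = (\<Sum>j\<in>UNIV. \<Sum>k\<in>UNIV. f w $ j $ k * (e j * e' k))"
      unfolding E[symmetric] by (intro sum.cong refl \<Psi>_scale c continuous_intros)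
    also have "\<dots> = char_eval p1 lam p2 mu M1 M2 (z1, z2) f"
      using f by (simp add: char_eval_def z1 z2 mult_ac)
    finally show ?thesis .
  qed
  \<comment> \<open>Off the carrier both functionals are \<open>undefined\<close>, so agreement on
    it is enough.\<close>
  moreover have "\<phi> \<in> extensional (carrier ?A)" using phi by (simp add: characters_def)
  ultimately have "\<phi> = char_eval p1 lam p2 mu M1 M2 (z1, z2)"
    by (intro extensionalityI[of _ "carrier ?A"]) (auto simp: char_eval_def)
  then show thesis using that z1 z2 w by (metis mem_Times_iff)
qed

theorem mainTheorem3:
  fixes p1 p2 :: "complex poly"
    and lam :: "'m::finite \<Rightarrow> complex" and mu :: "'n::finite \<Rightarrow> complex"
    and M1 M2 :: "complex set"
  assumes "lead_coeff p1 = 1" and "degree p1 = CARD('m)" and "enumerates_roots p1 lam"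
    and "lead_coeff p2 = 1" and "degree p2 = CARD('n)" and "enumerates_roots p2 mu"
    and "compact M1" and "compact M2"
  shows "characters (C_alg p1 lam p2 mu M1 M2) =
    {char_eval p1 lam p2 mu M1 M2 (z1, z2) | z1 z2. (z1, z2) \<in> (poly p1 -` M1) \<times> (poly p2 -` M2)}"
proof -
  have P: "monic_simple_roots p1 lam" and Q: "monic_simple_roots p2 mu"
    using assms by (simp_all add: monic_simple_roots_def)
  show ?thesis
    using char_eval_in_characters[OF P Q] character_is_char_eval[OF P Q assms(7,8)]
    by (simp add: set_eq_iff) metis
qed

end
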